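(* Consider the linear regression model $y=X\theta+u$ (context). Suppose that for a given $i\ge1$ with $i\le k=k(n)$ for all large enough $n$ we have $\xi_{i,n}\eta_{i,n}\to0$. Let $a_{i,n}$ be any sequence of non-negative reals, $E_{S,i,n}=[\tilde\theta_{S,i}-\hat\sigma a_{i,n},\tilde\theta_{S,i}+\hat\sigma a_{i,n}]$ and $C_{S,i,n}=[\hat\theta_{S,i}-\sigma a_{i,n},\hat\theta_{S,i}+\sigma a_{i,n}]$. Then, for any $\sigma>0$, $$\inf_{\theta\in\mathbb{R}^k,\sigma'\in(0,\infty)}P_{n,\theta,\sigma'}(\theta_i\in E_{S,i,n})-\inf_{\theta\in\mathbb{R}^k}P_{n,\theta,\sigma}(\theta_i\in C_{S,i,n})\longrightarrow0$$ as $n-k\to\infty$.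
   Context: Model: for each $n$, $y=X\theta+u$ with $y\in\mathbb{R}^n$, $X$ a non-stochastic $n\times k$ matrix of rank $k\ge1$ ($k=k(n)$ and all entries may depend on $n$), $\theta\in\mathbb{R}^k$, $u\sim N(0,\sigma^2I_n)$, $\sigma>0$. $P_{n,\theta,\sigma}$ is the probability under $(\theta,\sigma)$. $\hat\theta_{LS}=(X'X)^{-1}X'y$, $\hat\sigma^2=(y-X\hat\theta_{LS})'(y-X\hat\theta_{LS})/(n-k)$ (for $n>k$), $\xi_{i,n}\ge0$ with $\xi_{i,n}^2=((X'X/n)^{-1})_{ii}$. Standing assumption for asymptotic results: $\sup_n\xi_{i,n}^2/n<\infty$. Tuning parameters $\eta_{i,n}>0$. Soft-thresholding: known-variance $\hat\theta_{S,i}=\operatorname{sgn}(\hat\theta_{LS,i})(|\hat\theta_{LS,i}|-\sigma\xi_{i,n}\eta_{i,n})_+$, feasible $\tilde\theta_{S,i}=\operatorname{sgn}(\hat\theta_{LS,i})(|\hat\theta_{LS,i}|-\hat\sigma\xi_{i,n}\eta_{i,n})_+$. *)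

theory Defs
  imports "HOL-Probability.Probability"
begin

text \<open>Matrices are functions nat => nat => real with explicit dimensions;
  vectors in R^k are functions nat => real (only indices < k matter);
  indices are 0-based.\<close>

definition gram :: "nat \<Rightarrow> nat \<Rightarrow> (nat \<Rightarrow> nat \<Rightarrow> real) \<Rightarrow> nat \<Rightarrow> nat \<Rightarrow> real" where
  "gram n k X = (\<lambda>a b. \<Sum>j<n. X j a * X j b)"

definition matinv :: "nat \<Rightarrow> (nat \<Rightarrow> nat \<Rightarrow> real) \<Rightarrow> nat \<Rightarrow> nat \<Rightarrow> real" where
  "matinv k A = (THE B. (\<forall>a b. (k \<le> a \<or> k \<le> b) \<longrightarrow> B a b = 0) \<and>
      (\<forall>a<k. \<forall>b<k. (\<Sum>c<k. A a c * B c b) = (if a = b then 1 else 0)))"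

definition full_col_rank :: "nat \<Rightarrow> nat \<Rightarrow> (nat \<Rightarrow> nat \<Rightarrow> real) \<Rightarrow> bool" where
  "full_col_rank n k X \<longleftrightarrow>
     (\<forall>b. (\<forall>j<n. (\<Sum>c<k. X j c * b c) = 0) \<longrightarrow> (\<forall>c<k. b c = 0))"

definition Rk :: "nat \<Rightarrow> (nat \<Rightarrow> real) set" where
  "Rk k = {\<theta>. \<forall>j. k \<le> j \<longrightarrow> \<theta> j = 0}"

definition thetaLS :: "nat \<Rightarrow> nat \<Rightarrow> (nat \<Rightarrow> nat \<Rightarrow> real) \<Rightarrow> (nat \<Rightarrow> real) \<Rightarrow> nat \<Rightarrow> real" where
  "thetaLS n k X y i = (\<Sum>c<k. matinv k (gram n k X) i c * (\<Sum>j<n. X j c * y j))"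

definition sigma_hat :: "nat \<Rightarrow> nat \<Rightarrow> (nat \<Rightarrow> nat \<Rightarrow> real) \<Rightarrow> (nat \<Rightarrow> real) \<Rightarrow> real" where
  "sigma_hat n k X y =
     sqrt ((\<Sum>j<n. (y j - (\<Sum>c<k. X j c * thetaLS n k X y c))\<^sup>2) / (real n - real k))"

definition xi :: "nat \<Rightarrow> nat \<Rightarrow> (nat \<Rightarrow> nat \<Rightarrow> real) \<Rightarrow> nat \<Rightarrow> real" where
  "xi n k X i = sqrt (matinv k (\<lambda>a b. gram n k X a b / real n) i i)"

definition soft :: "real \<Rightarrow> real \<Rightarrow> real" where
  "soft t x = sgn x * max (\<bar>x\<bar> - t) 0"

definition thetaS :: "nat \<Rightarrow> nat \<Rightarrow> (nat \<Rightarrow> nat \<Rightarrow> real) \<Rightarrow> real \<Rightarrow> real \<Rightarrow> nat \<Rightarrow> (nat \<Rightarrow> real) \<Rightarrow> real" where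
  "thetaS n k X \<sigma> \<eta> i y = soft (\<sigma> * xi n k X i * \<eta>) (thetaLS n k X y i)"

definition thetaS_feas :: "nat \<Rightarrow> nat \<Rightarrow> (nat \<Rightarrow> nat \<Rightarrow> real) \<Rightarrow> real \<Rightarrow> nat \<Rightarrow> (nat \<Rightarrow> real) \<Rightarrow> real" where
  "thetaS_feas n k X \<eta> i y = soft (sigma_hat n k X y * xi n k X i * \<eta>) (thetaLS n k X y i)"

definition noise :: "nat \<Rightarrow> real \<Rightarrow> (nat \<Rightarrow> real) measure" where
  "noise n \<sigma> = PiM {..<n} (\<lambda>_. density lborel (normal_density 0 \<sigma>))"

definition Pmodel :: "nat \<Rightarrow> nat \<Rightarrow> (nat \<Rightarrow> nat \<Rightarrow> real) \<Rightarrow> (nat \<Rightarrow> real) \<Rightarrow> real \<Rightarrow>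
    ((nat \<Rightarrow> real) \<Rightarrow> bool) \<Rightarrow> real" where
  "Pmodel n k X \<theta> \<sigma> A =
     measure (noise n \<sigma>) {u \<in> space (noise n \<sigma>). A (\<lambda>j. (\<Sum>c<k. X j c * \<theta> c) + u j)}"

end

theory Submission
  imports "Jordan_Normal_Form.Determinant" Defs
begin

text \<open>
  Write \<open>e\<close> for the error of the least squares estimator of \<open>\<theta> i\<close> and \<open>S\<close> for the scale in use (\<open>\<sigma>\<close>, or
  its estimate), and put \<open>b = xi * \<eta>\<close>. Coverage is the event
  \<open>\<bar>soft (S * b) (\<theta> i + e) - \<theta> i\<bar> \<le> S * a\<close>. Pathwise it contains \<open>\<bar>e - S * b\<bar> \<le> S * a\<close> when \<open>\<theta> i \<ge> 0\<close>
  (and the mirror event otherwise), and it coincides with it once \<open>\<theta> i > S * a\<close>. For known variance the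
  infimum is therefore exactly the standard normal mass of a fixed interval. For the estimated scale
  the end points of that interval are multiplied by \<open>S / \<sigma>\<close>; moving an end point \<open>x\<close> by at most
  \<open>\<delta> * \<bar>x\<bar>\<close> changes the normal mass by at most \<open>2 * \<delta>\<close>, uniformly in \<open>x\<close>, because \<open>\<bar>x\<bar>\<close> times the normal
  density near \<open>x\<close> is bounded. So the two infima differ by at most
  \<open>4 * \<delta> + P(\<bar>S / \<sigma> - 1\<bar> > \<delta>)\<close>, and Chebyshev's inequality for the residual quadratic form bounds the
  last term by \<open>2 / (\<delta>\<^sup>2 * (n - k))\<close>.
\<close>

section \<open>Least squares algebra\<close>

text \<open>The difference of two right inverses has its columns in the kernel of \<open>A\<close>,
  so a trivial kernel makes the right inverse unique and the definite description in
  \<open>matinv\<close> denotes it. The zero padding settles the entries outside the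
  \<open>k\<close> by \<open>k\<close> block.\<close>

lemma matinv_eqI:
  assumes inj: "\<And>b. \<forall>a<k. (\<Sum>c<k. A a c * b c) = 0 \<Longrightarrow> \<forall>c<k. b c = 0"
    and B0: "\<And>a b. k \<le> a \<or> k \<le> b \<Longrightarrow> B a b = 0"
    and AB: "\<And>a b. a < k \<Longrightarrow> b < k \<Longrightarrow> (\<Sum>c<k. A a c * B c b) = (if a = b then 1 else 0)"
  shows "matinv k A = B"
  unfolding matinv_def
proof (rule the_equality)
  fix C
  assume C: "(\<forall>a b. (k \<le> a \<or> k \<le> b) \<longrightarrow> C a b = 0) \<and>
      (\<forall>a<k. \<forall>b<k. (\<Sum>c<k. A a c * C c b) = (if a = b then 1 else 0))"
  show "C = B"
  proof (intro ext)
    fix a b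
    show "C a b = B a b"
    proof (cases "k \<le> a \<or> k \<le> b")
      case True
      then show ?thesis using C B0 by auto
    next
      case False
      then have "\<forall>a'<k. (\<Sum>c<k. A a' c * (C c b - B c b)) = 0"
        using C AB by (simp add: right_diff_distrib sum_subtractf)
      then have "\<forall>c<k. C c b - B c b = 0"
        by (rule inj)
      then show ?thesis using False by auto
    qed
  qed
qed (use B0 AB in auto)

text \<open>A trivial kernel forces a nonzero determinant, hence a unit of the matrix ring. The
  inverse is carried back to functions and padded with zeros, the form that \<open>matinv\<close>
  asks for.\<close>

lemma right_inverse_exists:
  fixes A :: "nat \<Rightarrow> nat \<Rightarrow> real"
  assumes inj: "\<And>b. \<forall>a<k. (\<Sum>c<k. A a c * b c) = 0 \<Longrightarrow> \<forall>c<k. b c = 0"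
  obtains B where "\<And>a b. k \<le> a \<or> k \<le> b \<Longrightarrow> B a b = 0"
    and "\<And>a b. a < k \<Longrightarrow> b < k \<Longrightarrow> (\<Sum>c<k. A a c * B c b) = (if a = b then 1 else 0)"
proof -
  define MA where "MA = Matrix.mat k k (\<lambda>(a, b). A a b)"
  have MA: "MA \<in> carrier_mat k k"
    by (simp add: MA_def)
  have "Determinant.det MA \<noteq> 0"
  proof
    assume "Determinant.det MA = 0"
    then obtain v where v: "v \<in> carrier_vec k" "v \<noteq> 0\<^sub>v k" "MA *\<^sub>v v = 0\<^sub>v k"
      using det_0_iff_vec_prod_zero_field[OF MA] by blast
    have "\<forall>a<k. (\<Sum>c<k. A a c * vec_index v c) = 0"
    proof (intro allI impI)
      fix a assume a: "a < k"
      have "vec_index (MA *\<^sub>v v) a = (\<Sum>c<k. A a c * vec_index v c)"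
        using a v(1) by (simp add: MA_def scalar_prod_def atLeast0LessThan)
      then show "(\<Sum>c<k. A a c * vec_index v c) = 0"
        using v(3) a by simp
    qed
    then have "\<forall>c<k. vec_index v c = 0"
      by (rule inj)
    then have "v = 0\<^sub>v k"
      using v(1) by (intro eq_vecI) auto
    then show False using v(2) by simp
  qed
  from det_non_zero_imp_unit[OF MA this, of "()"]
  obtain MB where MB: "MB \<in> carrier_mat k k" "MA * MB = 1\<^sub>m k"
    by (auto simp: Units_def ring_mat_def)
  show ?thesis
  proof
    fix a b :: nat
    assume "k \<le> a \<or> k \<le> b"
    then show "(if a < k \<and> b < k then (MB $$ (a, b)) else 0) = 0"
      by auto
  next
    fix a b
    assume ab: "a < k" "b < k"
    have "(MA * MB) $$ (a, b) = (\<Sum>c<k. A a c * (MB $$ (c, b)))"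
      using ab MB(1) by (simp add: MA_def scalar_prod_def atLeast0LessThan)
    then show "(\<Sum>c<k. A a c * (if c < k \<and> b < k then (MB $$ (c, b)) else 0))
        = (if a = b then 1 else 0)"
      using MB(2) ab by simp
  qed
qed

text \<open>The quadratic form of the Gram matrix at \<open>b\<close> is the squared length of
  \<open>X b\<close>, so a kernel vector of the Gram matrix is already killed by
  \<open>X\<close>.\<close>

lemma gram_injective:
  assumes rank: "full_col_rank n k X" and b: "\<forall>a<k. (\<Sum>c<k. gram n k X a c * b c) = 0"
  shows "\<forall>c<k. b c = 0"
proof -
  have "(\<Sum>j<n. (\<Sum>c<k. X j c * b c)\<^sup>2) = (\<Sum>a<k. b a * (\<Sum>c<k. gram n k X a c * b c))"
  proof -
    have "(\<Sum>j<n. (\<Sum>c<k. X j c * b c)\<^sup>2)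
        = (\<Sum>j<n. \<Sum>a<k. \<Sum>c<k. b a * (X j a * X j c * b c))"
      by (simp add: power2_eq_square sum_product mult_ac)
    also have "\<dots> = (\<Sum>a<k. \<Sum>c<k. \<Sum>j<n. b a * (X j a * X j c * b c))"
      by (subst sum.swap) (intro sum.cong refl sum.swap)
    finally show ?thesis
      by (simp add: gram_def sum_distrib_left sum_distrib_right)
  qed
  also have "\<dots> = 0"
    using b by simp
  finally have "\<forall>j<n. (\<Sum>c<k. X j c * b c) = 0"
    by (simp add: sum_nonneg_eq_0_iff)
  then show ?thesis
    using rank by (simp add: full_col_rank_def)
qed

section \<open>The inverse Gram matrix, the hat matrix and the residual projection\<close>

locale full_rank_design =
  fixes n k :: nat and X :: "nat \<Rightarrow> nat \<Rightarrow> real"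
  assumes rank: "full_col_rank n k X"
begin

definition Ginv :: "nat \<Rightarrow> nat \<Rightarrow> real" where
  "Ginv = matinv k (gram n k X)"

text \<open>Row \<open>c\<close> of (X'X)^(-1) X': the weights with which the observations enter the
  least squares estimate of coordinate \<open>c\<close>.\<close>

definition lsw :: "nat \<Rightarrow> nat \<Rightarrow> real" where
  "lsw c j = (\<Sum>d<k. Ginv c d * X j d)"

definition hat :: "nat \<Rightarrow> nat \<Rightarrow> real" where
  "hat j l = (\<Sum>c<k. X j c * lsw c l)"

text \<open>On indices below \<open>n\<close>, the orthogonal projection onto the complement of the
  column space of \<open>X\<close>.\<close>

definition resid :: "nat \<Rightarrow> nat \<Rightarrow> real" where
  "resid j l = (if j = l then 1 else 0) - hat j l"

lemma gram_sym: "gram n k X a b = gram n k X b a"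
  by (simp add: gram_def mult.commute)

lemma Ginv_eq_0: "k \<le> a \<or> k \<le> b \<Longrightarrow> Ginv a b = 0"
  and gram_Ginv: "a < k \<Longrightarrow> b < k \<Longrightarrow> (\<Sum>c<k. gram n k X a c * Ginv c b) = (if a = b then 1 else 0)"
proof -
  obtain C where C: "\<And>a b. k \<le> a \<or> k \<le> b \<Longrightarrow> C a b = 0"
    "\<And>a b. a < k \<Longrightarrow> b < k \<Longrightarrow> (\<Sum>c<k. gram n k X a c * C c b) = (if a = b then 1 else 0)"
    using right_inverse_exists[of k "gram n k X"] gram_injective[OF rank] by blast
  have "Ginv = C"
    unfolding Ginv_def by (rule matinv_eqI) (use gram_injective[OF rank] C in auto)
  then show "k \<le> a \<or> k \<le> b \<Longrightarrow> Ginv a b = 0"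
    and "a < k \<Longrightarrow> b < k \<Longrightarrow> (\<Sum>c<k. gram n k X a c * Ginv c b) = (if a = b then 1 else 0)"
    using C by auto
qed

text \<open>\<open>matinv\<close> is specified as a right inverse only. With G for
  \<open>Ginv\<close> and A for the symmetric Gram matrix, the product G'AG is evaluated in two
  ways: AG = I gives G', and (AG)' = I gives G.\<close>

lemma Ginv_sym: "Ginv a b = Ginv b a"
proof (cases "a < k \<and> b < k")
  case True
  have "Ginv b a = (\<Sum>c<k. if c = b then Ginv c a else 0)"
    using True by simp
  also have "\<dots> = (\<Sum>c<k. Ginv c a * (\<Sum>d<k. gram n k X c d * Ginv d b))"
    using True by (intro sum.cong refl) (simp add: gram_Ginv)
  also have "\<dots> = (\<Sum>c<k. \<Sum>d<k. Ginv c a * (gram n k X c d * Ginv d b))"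
    by (simp add: sum_distrib_left)
  also have "\<dots> = (\<Sum>d<k. (\<Sum>c<k. gram n k X d c * Ginv c a) * Ginv d b)"
    by (subst sum.swap) (simp add: sum_distrib_left sum_distrib_right gram_sym mult_ac)
  also have "\<dots> = (\<Sum>d<k. if d = a then Ginv d b else 0)"
    using True by (intro sum.cong refl) (simp add: gram_Ginv)
  also have "\<dots> = Ginv a b"
    using True by simp
  finally show ?thesis by simp
next
  case False
  then show ?thesis using Ginv_eq_0[of a b] Ginv_eq_0[of b a] by auto
qed

lemma Ginv_gram:
  assumes "a < k" "b < k"
  shows "(\<Sum>c<k. Ginv a c * gram n k X c b) = (if a = b then 1 else 0)"
proof -
  have "(\<Sum>c<k. Ginv a c * gram n k X c b) = (\<Sum>c<k. gram n k X b c * Ginv c a)"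
    by (intro sum.cong refl) (metis Ginv_sym gram_sym mult.commute)
  then show ?thesis using gram_Ginv[of b a] assms by auto
qed

lemma xi_eq: "n > 0 \<Longrightarrow> xi n k X i = sqrt (real n * Ginv i i)"
proof -
  assume n: "n > 0"
  have "matinv k (\<lambda>a b. gram n k X a b / real n) = (\<lambda>a b. real n * Ginv a b)"
  proof (rule matinv_eqI)
    fix b assume *: "\<forall>a<k. (\<Sum>c<k. gram n k X a c / real n * b c) = 0"
    have "\<forall>a<k. (\<Sum>c<k. gram n k X a c * b c) = 0"
    proof (intro allI impI)
      fix a assume "a < k"
      have "(\<Sum>c<k. gram n k X a c * b c) = real n * (\<Sum>c<k. gram n k X a c / real n * b c)"
        using n by (simp add: sum_distrib_left)
      also have "\<dots> = 0"
        using * \<open>a < k\<close> by simp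
      finally show "(\<Sum>c<k. gram n k X a c * b c) = 0" .
    qed
    then show "\<forall>c<k. b c = 0"
      by (rule gram_injective[OF rank])
  qed (use n in \<open>simp_all add: Ginv_eq_0 gram_Ginv\<close>)
  then show ?thesis
    by (simp add: xi_def)
qed

lemma thetaLS_eq: "thetaLS n k X y i = (\<Sum>j<n. lsw i j * y j)"
proof -
  have "thetaLS n k X y i = (\<Sum>c<k. \<Sum>j<n. Ginv i c * X j c * y j)"
    by (simp add: thetaLS_def Ginv_def sum_distrib_left mult.assoc)
  also have "\<dots> = (\<Sum>j<n. lsw i j * y j)"
    by (subst sum.swap) (simp add: lsw_def sum_distrib_right)
  finally show ?thesis .
qed

text \<open>The weights form a left inverse of \<open>X\<close>, which is unbiasedness of least
  squares. Most identities below collapse through this one.\<close>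

lemma lsw_X:
  assumes "a < k" "b < k"
  shows "(\<Sum>j<n. lsw a j * X j b) = (if a = b then 1 else 0)"
proof -
  have "(\<Sum>j<n. lsw a j * X j b) = (\<Sum>j<n. \<Sum>c<k. Ginv a c * (X j c * X j b))"
    by (simp add: lsw_def sum_distrib_right mult.assoc)
  also have "\<dots> = (\<Sum>c<k. Ginv a c * gram n k X c b)"
    by (subst sum.swap) (simp add: gram_def sum_distrib_left)
  finally show ?thesis using Ginv_gram[OF assms] by simp
qed

text \<open>Diagonal of GX'XG = G. Multiplied by the error variance, this is the variance of the
  least squares estimate.\<close>

lemma lsw_norm: "a < k \<Longrightarrow> (\<Sum>j<n. (lsw a j)\<^sup>2) = Ginv a a"
proof -
  assume a: "a < k"
  have "(\<Sum>j<n. (lsw a j)\<^sup>2) = (\<Sum>j<n. \<Sum>d<k. Ginv a d * (lsw a j * X j d))"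
    by (subst power2_eq_square, subst (2) lsw_def) (simp add: sum_distrib_left algebra_simps)
  also have "\<dots> = (\<Sum>d<k. Ginv a d * (\<Sum>j<n. lsw a j * X j d))"
    by (subst sum.swap) (simp add: sum_distrib_left)
  also have "\<dots> = Ginv a a"
    using a by (simp add: lsw_X if_distrib cong: if_cong)
  finally show ?thesis .
qed

text \<open>Otherwise the weight row \<open>lsw a\<close> would vanish, although its product with
  column \<open>a\<close> of \<open>X\<close> is 1.\<close>

lemma Ginv_diag_pos:
  assumes a: "a < k"
  shows "Ginv a a > 0"
proof (rule ccontr)
  assume "\<not> Ginv a a > 0"
  then have "(\<Sum>j<n. (lsw a j)\<^sup>2) \<le> 0"
    using lsw_norm[OF a] by simp
  then have "(\<Sum>j<n. (lsw a j)\<^sup>2) = 0"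
    by (intro order.antisym sum_nonneg) auto
  then have "\<forall>j<n. lsw a j = 0"
    by (simp add: sum_nonneg_eq_0_iff)
  then show False
    using lsw_X[OF a a] by simp
qed

lemma hat_sym: "hat a b = hat b a"
proof -
  have "hat a b = (\<Sum>c<k. \<Sum>d<k. X a c * Ginv c d * X b d)"
    by (simp add: hat_def lsw_def sum_distrib_left mult.assoc)
  also have "\<dots> = (\<Sum>d<k. \<Sum>c<k. X a c * Ginv c d * X b d)"
    by (rule sum.swap)
  also have "\<dots> = (\<Sum>d<k. \<Sum>c<k. X b d * Ginv d c * X a c)"
    by (intro sum.cong refl) (metis Ginv_sym mult.commute mult.left_commute)
  also have "\<dots> = hat b a"
    by (simp add: hat_def lsw_def sum_distrib_left mult.assoc)
  finally show ?thesis .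
qed

lemma hat_idem: "(\<Sum>j<n. hat a j * hat j b) = hat a b"
proof -
  have "(\<Sum>j<n. hat a j * hat j b) = (\<Sum>j<n. \<Sum>c<k. \<Sum>d<k. X a c * lsw d b * (lsw c j * X j d))"
    by (simp only: hat_def sum_product) (simp add: mult_ac)
  also have "\<dots> = (\<Sum>c<k. \<Sum>d<k. \<Sum>j<n. X a c * lsw d b * (lsw c j * X j d))"
    by (subst sum.swap) (intro sum.cong refl sum.swap)
  also have "\<dots> = (\<Sum>c<k. \<Sum>d<k. X a c * lsw d b * (\<Sum>j<n. lsw c j * X j d))"
    by (simp add: sum_distrib_left)
  also have "\<dots> = (\<Sum>c<k. \<Sum>d<k. if c = d then X a c * lsw d b else 0)"
    by (intro sum.cong refl) (simp add: lsw_X)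
  also have "\<dots> = hat a b"
    by (simp add: hat_def)
  finally show ?thesis .
qed

lemma resid_sym: "resid a b = resid b a"
  by (simp add: resid_def hat_sym[of a b] eq_commute[of a b])

lemma resid_idem:
  assumes "a < n" "b < n"
  shows "(\<Sum>j<n. resid a j * resid j b) = resid a b"
proof -
  have "(\<Sum>j<n. resid a j * resid j b)
      = (\<Sum>j<n. ((if j = a then (if j = b then 1 else 0) else 0) - (if j = a then hat j b else 0)
          - (if j = b then hat a j else 0)) + hat a j * hat j b)"
    by (intro sum.cong refl) (auto simp: resid_def algebra_simps)
  also have "\<dots> = resid a b"
    using assms by (simp add: sum.distrib sum_subtractf hat_idem) (simp add: resid_def)
  finally show ?thesis .
qed

text \<open>Swapping the two factors under the trace turns the \<open>n\<close> by \<open>n\<close>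
  hat matrix into the \<open>k\<close> by \<open>k\<close> identity.\<close>

lemma resid_trace: "(\<Sum>j<n. resid j j) = real n - real k"
proof -
  have "(\<Sum>j<n. hat j j) = (\<Sum>c<k. \<Sum>j<n. lsw c j * X j c)"
    by (subst sum.swap) (simp add: hat_def mult.commute)
  also have "\<dots> = real k"
    by (simp add: lsw_X)
  finally show ?thesis
    by (simp add: resid_def sum_subtractf)
qed

lemma thetaLS_model:
  assumes "i < k"
  shows "thetaLS n k X (\<lambda>j. (\<Sum>c<k. X j c * \<theta> c) + u j) i = \<theta> i + (\<Sum>j<n. lsw i j * u j)"
proof -
  have "(\<Sum>j<n. lsw i j * (\<Sum>c<k. X j c * \<theta> c)) = (\<Sum>c<k. (\<Sum>j<n. lsw i j * X j c) * \<theta> c)"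
    unfolding sum_distrib_left sum_distrib_right by (subst sum.swap) (simp add: mult.assoc)
  also have "\<dots> = (\<Sum>c<k. if i = c then \<theta> c else 0)"
    using assms by (intro sum.cong refl) (simp add: lsw_X)
  also have "\<dots> = \<theta> i"
    using assms by simp
  finally show ?thesis
    by (simp add: thetaLS_eq algebra_simps sum.distrib)
qed

text \<open>The residual projection R kills the columns of \<open>X\<close>, so the residual vector
  is R u, and its squared length is u'Ru because R is symmetric and idempotent. The result is free
  of \<theta>, so one concentration bound serves all parameters.\<close>

lemma sigma_hat_model:
  "sigma_hat n k X (\<lambda>j. (\<Sum>c<k. X j c * \<theta> c) + u j)
    = sqrt ((\<Sum>a<n. \<Sum>b<n. resid a b * (u a * u b)) / (real n - real k))"
proof -
  have res: "(\<Sum>c<k. X j c * \<theta> c) + u j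
      - (\<Sum>c<k. X j c * thetaLS n k X (\<lambda>j. (\<Sum>c<k. X j c * \<theta> c) + u j) c)
      = (\<Sum>l<n. resid j l * u l)" if j: "j < n" for j
  proof -
    have "(\<Sum>c<k. X j c * (\<Sum>l<n. lsw c l * u l)) = (\<Sum>l<n. hat j l * u l)"
      unfolding hat_def sum_distrib_left sum_distrib_right by (subst sum.swap) (simp add: mult.assoc)
    moreover have "(\<Sum>l<n. resid j l * u l) = (\<Sum>l<n. (if j = l then u l else 0) - hat j l * u l)"
      by (intro sum.cong refl) (simp add: resid_def algebra_simps)
    moreover have "(\<Sum>c<k. X j c * thetaLS n k X (\<lambda>j. (\<Sum>c<k. X j c * \<theta> c) + u j) c)
        = (\<Sum>c<k. X j c * \<theta> c) + (\<Sum>c<k. X j c * (\<Sum>l<n. lsw c l * u l))"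
      by (simp add: thetaLS_model distrib_left sum.distrib)
    ultimately show ?thesis
      using j by (simp add: sum_subtractf)
  qed
  have "(\<Sum>j<n. (\<Sum>l<n. resid j l * u l)\<^sup>2) = (\<Sum>j<n. \<Sum>a<n. \<Sum>b<n. (resid a j * resid j b) * (u a * u b))"
  proof (intro sum.cong refl)
    fix j
    show "(\<Sum>l<n. resid j l * u l)\<^sup>2 = (\<Sum>a<n. \<Sum>b<n. (resid a j * resid j b) * (u a * u b))"
      by (simp add: power2_eq_square sum_product resid_sym[of _ j] mult_ac)
  qed
  also have "\<dots> = (\<Sum>a<n. \<Sum>b<n. \<Sum>j<n. (resid a j * resid j b) * (u a * u b))"
    by (subst sum.swap) (intro sum.cong refl sum.swap)
  also have "\<dots> = (\<Sum>a<n. \<Sum>b<n. resid a b * (u a * u b))"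
    by (intro sum.cong refl) (simp add: resid_idem flip: sum_distrib_right)
  finally show ?thesis
    using res by (simp add: sigma_hat_def)
qed

end

section \<open>Soft thresholding and rescaled normal intervals\<close>

lemma soft_eq:
  "0 \<le> t \<Longrightarrow> soft t x = (if t < x then x - t else if x < - t then x + t else 0)"
  by (auto simp: soft_def sgn_if max_def)

lemma soft_minus: "soft t (- x) = - soft t x"
  by (simp add: soft_def)

text \<open>If \<open>t < \<theta> + e\<close>, the estimation error equals \<open>e - t\<close>. In
  the other two branches it lies between \<open>e - t\<close> and 0, since \<theta> is
  nonnegative.\<close>

lemma soft_covers:
  assumes "0 \<le> t" "0 \<le> \<theta>" "\<bar>e - t\<bar> \<le> r"
  shows "\<bar>soft t (\<theta> + e) - \<theta>\<bar> \<le> r"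
  using assms by (auto simp: soft_eq abs_le_iff)

lemma soft_covers_neg:
  assumes "0 \<le> t" "\<theta> \<le> 0" "\<bar>e + t\<bar> \<le> r"
  shows "\<bar>soft t (\<theta> + e) - \<theta>\<bar> \<le> r"
proof -
  have "\<bar>soft t (- \<theta> + - e) - - \<theta>\<bar> \<le> r"
    by (rule soft_covers) (use assms in auto)
  moreover have "soft t (- \<theta> + - e) = - soft t (\<theta> + e)"
    using soft_minus[of t "\<theta> + e"] by simp
  ultimately show ?thesis
    by linarith
qed

text \<open>Coverage with \<open>r < \<theta>\<close> forces a positive estimate, so only the branch
  with error exactly \<open>e - t\<close> remains.\<close>

lemma soft_covers_far:
  assumes "0 \<le> t" "r < \<theta>" "\<bar>soft t (\<theta> + e) - \<theta>\<bar> \<le> r"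
  shows "\<bar>e - t\<bar> \<le> r"
  using assms by (auto simp: soft_eq abs_le_iff split: if_splits)

lemma soft_measurable [measurable]:
  assumes [measurable]: "f \<in> borel_measurable M" "h \<in> borel_measurable M"
  shows "(\<lambda>x. soft (f x) (h x)) \<in> borel_measurable M"
  unfolding soft_def by measurable

section \<open>Normal mass of intervals with perturbed end points\<close>

abbreviation std_normal :: "real measure" where
  "std_normal \<equiv> density lborel (normal_density 0 1)"

text \<open>Such a \<open>y\<close> satisfies \<open>\<bar>x\<bar> / 2 \<le> \<bar>y\<bar>\<close>;
  then exp(z) >= 1 + z and sqrt(2 pi) >= 2 suffice. The bound decays quadratically in
  \<open>x\<close>, which outweighs an interval length proportional to
  \<open>\<bar>x\<bar>\<close>.\<close>

lemma std_normal_density_near: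
  assumes \<delta>: "0 \<le> \<delta>" "\<delta> \<le> 1/2" and y: "\<bar>y - x\<bar> \<le> \<delta> * \<bar>x\<bar>"
  shows "normal_density 0 1 y \<le> 1 / (2 * (1 + x\<^sup>2 / 8))"
proof -
  have "\<delta> * \<bar>x\<bar> \<le> 1/2 * \<bar>x\<bar>"
    using \<delta> by (intro mult_right_mono) auto
  then have "\<bar>x\<bar> / 2 \<le> \<bar>y\<bar>"
    using y by linarith
  then have "(\<bar>x\<bar> / 2)\<^sup>2 \<le> \<bar>y\<bar>\<^sup>2"
    by (intro power_mono) auto
  then have "1 + x\<^sup>2 / 8 \<le> 1 + y\<^sup>2 / 2"
    by (simp add: power_divide)
  also have "\<dots> \<le> exp (y\<^sup>2 / 2)"
    by (rule exp_ge_add_one_self)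
  finally have e: "1 + x\<^sup>2 / 8 \<le> exp (y\<^sup>2 / 2)" .
  have s: "2 \<le> sqrt (2 * pi)"
    using pi_gt3 by (intro real_le_rsqrt) simp
  have "0 < 1 + x\<^sup>2 / 8"
    by (smt (verit) zero_le_power2 divide_nonneg_pos)
  then have "2 * (1 + x\<^sup>2 / 8) \<le> sqrt (2 * pi) * exp (y\<^sup>2 / 2)"
    using e s by (intro mult_mono) auto
  then have "1 / (sqrt (2 * pi) * exp (y\<^sup>2 / 2)) \<le> 1 / (2 * (1 + x\<^sup>2 / 8))"
    using \<open>0 < 1 + x\<^sup>2 / 8\<close> by (intro divide_left_mono mult_pos_pos) auto
  then show ?thesis
    by (simp add: normal_density_def exp_minus field_simps)
qed

lemma std_normal_near:
  assumes \<delta>: "0 \<le> \<delta>" "\<delta> \<le> 1/2"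
  shows "measure std_normal {x - \<delta> * \<bar>x\<bar> .. x + \<delta> * \<bar>x\<bar>} \<le> 2 * \<delta>"
proof -
  define K where "K = 1 / (2 * (1 + x\<^sup>2 / 8))"
  have pos: "0 < 1 + x\<^sup>2 / 8"
    by (smt (verit) zero_le_power2 divide_nonneg_pos)
  then have K: "0 \<le> K"
    by (simp add: K_def)
  define A where "A = {x - \<delta> * \<bar>x\<bar> .. x + \<delta> * \<bar>x\<bar>}"
  have "emeasure std_normal A = (\<integral>\<^sup>+y. ennreal (normal_density 0 1 y) * indicator A y \<partial>lborel)"
    by (rule emeasure_density) (auto simp: A_def)
  also have "\<dots> \<le> (\<integral>\<^sup>+y. ennreal K * indicator A y \<partial>lborel)"
  proof (intro nn_integral_mono)
    fix y
    show "ennreal (normal_density 0 1 y) * indicator A y \<le> ennreal K * indicator A y"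
    proof (cases "y \<in> A")
      case True
      then have "\<bar>y - x\<bar> \<le> \<delta> * \<bar>x\<bar>"
        by (auto simp: A_def)
      then show ?thesis
        using std_normal_density_near[OF \<delta>] True by (simp add: K_def ennreal_leI)
    qed simp
  qed
  also have "\<dots> = ennreal (K * (2 * (\<delta> * \<bar>x\<bar>)))"
    using \<delta> K by (simp add: nn_integral_cmult_indicator A_def ennreal_mult)
  finally have "measure std_normal A \<le> K * (2 * (\<delta> * \<bar>x\<bar>))"
    using \<delta> K by (simp add: measure_def enn2real_leI)
  also have "\<dots> = \<delta> * (\<bar>x\<bar> / (1 + x\<^sup>2 / 8))"
    using pos by (simp add: K_def field_simps)
  also have "\<dots> \<le> \<delta> * 2"
  proof (rule mult_left_mono)
    \<comment> \<open>Expanding this square gives |x| <= 1 + x^2/4, which is below 2 (1 +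
      x^2/8).\<close>
    have "0 \<le> (\<bar>x\<bar> / 2 - 1)\<^sup>2"
      by simp
    then have "\<bar>x\<bar> \<le> 2 * (1 + x\<^sup>2 / 8)"
      by (simp add: power2_diff power_divide)
    then show "\<bar>x\<bar> / (1 + x\<^sup>2 / 8) \<le> 2"
      using pos by (simp add: divide_le_eq)
  qed (use \<delta> in simp)
  finally show ?thesis
    by (simp add: A_def mult.commute)
qed

context prob_space
begin

lemma prob_std_normal:
  assumes "distributed M lborel Z (normal_density 0 1)" and [measurable]: "A \<in> sets borel"
  shows "prob {\<omega> \<in> space M. Z \<omega> \<in> A} = measure std_normal A"
proof -
  have [measurable]: "Z \<in> borel_measurable M"
    using distributed_measurable[OF assms(1)] by simp
  have "distr M lborel Z = std_normal"
    using distributed_distr_eq_density[OF assms(1)] .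
  then show ?thesis
    by (simp add: measure_distr vimage_def Int_def conj_commute flip: \<open>distr M lborel Z = std_normal\<close>)
qed

text \<open>The events Z in [x1, x2] and Z in [W x1, W x2] can differ only if \<open>W\<close> is
  not near 1 or Z falls into a band around \<open>x1\<close> or \<open>x2\<close>. Each band costs
  \<open>2 * \<delta>\<close> and the first exception costs \<open>p\<close>. This is a union bound,
  so the joint law of \<open>W\<close> and \<open>Z\<close> does not matter.\<close>

lemma rescaled_interval_prob:
  fixes W Z :: "'a \<Rightarrow> real"
  assumes Z: "distributed M lborel Z (normal_density 0 1)"
    and W [measurable]: "random_variable borel W"
    and \<delta>: "0 \<le> \<delta>" "\<delta> \<le> 1/2"
    and W_near: "prob {\<omega> \<in> space M. \<not> \<bar>W \<omega> - 1\<bar> \<le> \<delta>} \<le> p"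
    and A [measurable]: "{\<omega> \<in> space M. A \<omega>} \<in> events"
  shows rescaled_interval_prob_ge:
    "(\<And>\<omega>. \<omega> \<in> space M \<Longrightarrow> \<bar>W \<omega> - 1\<bar> \<le> \<delta> \<Longrightarrow> W \<omega> * x1 \<le> Z \<omega> \<Longrightarrow> Z \<omega> \<le> W \<omega> * x2 \<Longrightarrow> A \<omega>)
      \<Longrightarrow> measure std_normal {x1..x2} - 4 * \<delta> - p \<le> prob {\<omega> \<in> space M. A \<omega>}"
    and rescaled_interval_prob_le:
    "(\<And>\<omega>. \<omega> \<in> space M \<Longrightarrow> \<bar>W \<omega> - 1\<bar> \<le> \<delta> \<Longrightarrow> A \<omega> \<Longrightarrow> W \<omega> * x1 \<le> Z \<omega> \<and> Z \<omega> \<le> W \<omega> * x2)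
      \<Longrightarrow> prob {\<omega> \<in> space M. A \<omega>} \<le> measure std_normal {x1..x2} + 4 * \<delta> + p"
proof -
  have [measurable]: "Z \<in> borel_measurable M"
    using distributed_measurable[OF Z] by simp
  define I where "I x = {x - \<delta> * \<bar>x\<bar> .. x + \<delta> * \<bar>x\<bar>}" for x :: real
  let ?E = "\<lambda>A. {\<omega> \<in> space M. Z \<omega> \<in> A}"
  let ?F = "{\<omega> \<in> space M. \<not> \<bar>W \<omega> - 1\<bar> \<le> \<delta>}"
  let ?A = "{\<omega> \<in> space M. A \<omega>}"
  have [measurable]: "I x \<in> sets borel" for x
    by (simp add: I_def)
  have I: "prob (?E (I x)) \<le> 2 * \<delta>" for x
    using prob_std_normal[OF Z, of "I x"] std_normal_near[OF \<delta>, of x] by (simp add: I_def)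
  have N: "prob (?E {x1..x2}) = measure std_normal {x1..x2}"
    using prob_std_normal[OF Z, of "{x1..x2}"] by simp
  \<comment> \<open>If \<open>z\<close> compares differently with \<open>w * x\<close> and with
    \<open>x\<close>, it lies between the two, which are at most
    \<open>\<delta> * \<bar>x\<bar>\<close> apart.\<close>
  have cross: "z \<in> I x" if "\<bar>w - 1\<bar> \<le> \<delta>" "(w * x \<le> z) \<noteq> (x \<le> z) \<or> (z \<le> w * x) \<noteq> (z \<le> x)" for w x z
  proof -
    have "\<bar>w * x - x\<bar> = \<bar>w - 1\<bar> * \<bar>x\<bar>"
      by (simp flip: abs_mult add: algebra_simps)
    also have "\<dots> \<le> \<delta> * \<bar>x\<bar>"
      using that(1) by (intro mult_right_mono) auto
    finally show ?thesis
      using that(2) by (auto simp: I_def abs_le_iff)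
  qed
  have bound: "prob (X \<union> ?E (I x1) \<union> ?E (I x2) \<union> ?F) \<le> prob X + 4 * \<delta> + p"
    if [measurable]: "X \<in> events" for X
  proof -
    have "prob (X \<union> ?E (I x1) \<union> ?E (I x2) \<union> ?F)
        \<le> prob (X \<union> ?E (I x1) \<union> ?E (I x2)) + prob ?F"
      by (rule measure_Un_le) measurable
    also have "\<dots> \<le> prob (X \<union> ?E (I x1)) + prob (?E (I x2)) + prob ?F"
      by (intro add_right_mono measure_Un_le) measurable
    also have "\<dots> \<le> prob X + prob (?E (I x1)) + prob (?E (I x2)) + prob ?F"
      by (intro add_right_mono measure_Un_le) measurable
    finally show ?thesis
      using I[of x1] I[of x2] W_near by linarith
  qed
  show "measure std_normal {x1..x2} - 4 * \<delta> - p \<le> prob ?A"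
    if "\<And>\<omega>. \<omega> \<in> space M \<Longrightarrow> \<bar>W \<omega> - 1\<bar> \<le> \<delta> \<Longrightarrow> W \<omega> * x1 \<le> Z \<omega> \<Longrightarrow> Z \<omega> \<le> W \<omega> * x2 \<Longrightarrow> A \<omega>"
  proof -
    have "?E {x1..x2} \<subseteq> ?A \<union> ?E (I x1) \<union> ?E (I x2) \<union> ?F"
      using that cross by (auto 4 3)
    then have "prob (?E {x1..x2}) \<le> prob (?A \<union> ?E (I x1) \<union> ?E (I x2) \<union> ?F)"
      by (rule finite_measure_mono) measurable
    with bound[of ?A] N show ?thesis
      by simp
  qed
  show "prob ?A \<le> measure std_normal {x1..x2} + 4 * \<delta> + p"
    if "\<And>\<omega>. \<omega> \<in> space M \<Longrightarrow> \<bar>W \<omega> - 1\<bar> \<le> \<delta> \<Longrightarrow> A \<omega> \<Longrightarrow> W \<omega> * x1 \<le> Z \<omega> \<and> Z \<omega> \<le> W \<omega> * x2"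
  proof -
    have "?A \<subseteq> ?E {x1..x2} \<union> ?E (I x1) \<union> ?E (I x2) \<union> ?F"
      using that cross by (auto 4 3)
    then have "prob ?A \<le> prob (?E {x1..x2} \<union> ?E (I x1) \<union> ?E (I x2) \<union> ?F)"
      by (rule finite_measure_mono) measurable
    with bound[of "?E {x1..x2}"] N show ?thesis
      by simp
  qed
qed

end

section \<open>Linear and quadratic forms in Gaussian noise\<close>

locale gaussian_noise =
  fixes n :: nat and \<sigma> :: real
  assumes \<sigma>_pos: "\<sigma> > 0"
begin

abbreviation N :: "real measure" where
  "N \<equiv> density lborel (normal_density 0 \<sigma>)"

lemma prob_space_N: "prob_space N"
  using prob_space_normal_density[OF \<sigma>_pos] .

sublocale prob_space "noise n \<sigma>"
  unfolding noise_def by (rule prob_space_PiM) (rule prob_space_N)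

lemma coord_measurable [measurable]: "j < n \<Longrightarrow> (\<lambda>u. u j) \<in> borel_measurable (noise n \<sigma>)"
proof -
  assume "j < n"
  then have "(\<lambda>u. u j) \<in> measurable (noise n \<sigma>) N"
    unfolding noise_def by (intro measurable_component_singleton) simp
  then show ?thesis
    by simp
qed

lemma distr_coord: "j < n \<Longrightarrow> distr (noise n \<sigma>) borel (\<lambda>u. u j) = N"
proof -
  assume "j < n"
  then have "distr (noise n \<sigma>) N (\<lambda>u. u j) = N"
    unfolding noise_def by (intro distr_PiM_component prob_space_N) auto
  moreover have "distr (noise n \<sigma>) N (\<lambda>u. u j) = distr (noise n \<sigma>) borel (\<lambda>u. u j)"
    by (rule distr_cong) auto
  ultimately show ?thesis
    by simp
qed

lemma distributed_coord:
  assumes j: "j < n"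
  shows "distributed (noise n \<sigma>) lborel (\<lambda>u. u j) (normal_density 0 \<sigma>)"
  unfolding distributed_def
proof (intro conjI)
  show "distr (noise n \<sigma>) lborel (\<lambda>u. u j) = N"
    using distr_coord[OF j] by (simp cong: distr_cong)
qed (use j in \<open>auto intro: coord_measurable\<close>)

text \<open>Collecting the coordinates is the identity map, so their joint law is the noise itself,
  which is the product of the coordinate laws.\<close>

lemma indep_coords: "n > 0 \<Longrightarrow> indep_vars (\<lambda>_. borel) (\<lambda>j u. u j) {..<n}"
proof (subst indep_vars_iff_distr_eq_PiM')
  have "distr (noise n \<sigma>) (PiM {..<n} (\<lambda>_. borel)) (\<lambda>u. \<lambda>j\<in>{..<n}. u j)
      = distr (noise n \<sigma>) (noise n \<sigma>) (\<lambda>u. u)"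
    by (rule distr_cong) (auto simp: noise_def space_PiM fun_eq_iff PiE_def extensional_def
        restrict_def intro!: sets_PiM_cong)
  also have "\<dots> = PiM {..<n} (\<lambda>j. distr (noise n \<sigma>) borel (\<lambda>u. u j))"
    by (simp add: noise_def cong: PiM_cong) (intro PiM_cong refl, simp flip: noise_def add: distr_coord)
  finally show "distr (noise n \<sigma>) (PiM {..<n} (\<lambda>_. borel)) (\<lambda>u. \<lambda>j\<in>{..<n}. u j)
      = PiM {..<n} (\<lambda>j. distr (noise n \<sigma>) borel (\<lambda>u. u j))" .
qed auto

lemma distributed_linear:
  assumes w: "(\<Sum>j<n. (w j)\<^sup>2) > 0"
  shows "distributed (noise n \<sigma>) lborel (\<lambda>u. \<Sum>j<n. w j * u j)
    (normal_density 0 (\<sigma> * sqrt (\<Sum>j<n. (w j)\<^sup>2)))"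
proof -
  \<comment> \<open>Zero weights are dropped: a coordinate scaled by 0 has no density, while the sum
    rule for normal variables asks for positive standard deviations.\<close>
  define I where "I = {j. j < n \<and> w j \<noteq> 0}"
  have fin: "finite I"
    by (simp add: I_def)
  have sums: "(\<Sum>j<n. f j) = (\<Sum>j\<in>I. f j)" if "\<And>j. w j = 0 \<Longrightarrow> f j = 0" for f :: "nat \<Rightarrow> real"
    using that by (intro sum.mono_neutral_right) (auto simp: I_def)
  have "I \<noteq> {}"
    using w sums[of "\<lambda>j. (w j)\<^sup>2"] by auto
  then have n: "n > 0"
    by (auto simp: I_def)
  have "indep_vars (\<lambda>_. borel) (\<lambda>j u. u j) I"
    using indep_coords[OF n] by (rule indep_vars_subset) (auto simp: I_def)
  then have ind: "indep_vars (\<lambda>_. borel) (\<lambda>j u. w j * u j) I"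
    by (rule indep_vars_compose2) auto
  have "distributed (noise n \<sigma>) lborel (\<lambda>u. \<Sum>j\<in>I. w j * u j)
      (normal_density (\<Sum>j\<in>I. 0) (sqrt (\<Sum>j\<in>I. (\<bar>w j\<bar> * \<sigma>)\<^sup>2)))"
  proof (rule sum_indep_normal[OF fin \<open>I \<noteq> {}\<close> ind])
    fix j assume "j \<in> I"
    then show "0 < \<bar>w j\<bar> * \<sigma>"
      using \<sigma>_pos by (simp add: I_def)
    show "distributed (noise n \<sigma>) lborel (\<lambda>u. w j * u j) (normal_density 0 (\<bar>w j\<bar> * \<sigma>))"
      using normal_density_affine[OF distributed_coord \<sigma>_pos, of j "w j" 0] \<open>j \<in> I\<close>
      by (simp add: I_def)
  qed
  moreover have "sqrt (\<Sum>j\<in>I. (\<bar>w j\<bar> * \<sigma>)\<^sup>2) = \<sigma> * sqrt (\<Sum>j<n. (w j)\<^sup>2)"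
  proof -
    have "(\<Sum>j\<in>I. (\<bar>w j\<bar> * \<sigma>)\<^sup>2) = \<sigma>\<^sup>2 * (\<Sum>j<n. (w j)\<^sup>2)"
      by (simp add: sums power_mult_distrib sum_distrib_left mult.commute)
    then show ?thesis
      using \<sigma>_pos by (simp add: real_sqrt_mult)
  qed
  ultimately show ?thesis
    by (simp add: sums)
qed

section \<open>Moments up to order four and the variance of a quadratic form\<close>

definition moment :: "nat \<Rightarrow> real" where
  "moment e = (\<integral>x. x ^ e \<partial>N)"

lemma integrable_power: "integrable N (\<lambda>x. x ^ e)"
  using integrable_normal_moment[OF \<sigma>_pos, of 0 e]
  by (simp add: integrable_density)

lemma moment_eq: "moment e = (\<integral>x. normal_density 0 \<sigma> x * x ^ e \<partial>lborel)"
  by (simp add: moment_def integral_density)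

lemma moment_simps:
  "moment 0 = 1" "moment (Suc 0) = 0" "moment (Suc (Suc 0)) = \<sigma>\<^sup>2"
  "moment (Suc (Suc (Suc 0))) = 0" "moment (Suc (Suc (Suc (Suc 0)))) = 3 * \<sigma> ^ 4"
proof -
  have "moment 4 = 3 * \<sigma> ^ 4"
    using integral_normal_moment_even[OF \<sigma>_pos, of 0 2] \<sigma>_pos
    by (simp add: moment_eq fact_numeral field_simps flip: power_mult)
  then show "moment (Suc (Suc (Suc (Suc 0)))) = 3 * \<sigma> ^ 4"
    by (simp add: eval_nat_numeral)
  have "moment 3 = 0"
    using integral_normal_moment_odd[OF \<sigma>_pos, of 0 1] by (simp add: moment_eq)
  then show "moment (Suc (Suc (Suc 0))) = 0"
    by (simp add: eval_nat_numeral)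
  have "moment 2 = \<sigma>\<^sup>2"
    using integral_normal_moment_even[OF \<sigma>_pos, of 0 1] \<sigma>_pos by (simp add: moment_eq fact_numeral)
  then show "moment (Suc (Suc 0)) = \<sigma>\<^sup>2"
    by (simp add: eval_nat_numeral)
  show "moment 0 = 1" "moment (Suc 0) = 0"
    using integral_normal_moment_even[OF \<sigma>_pos, of 0 0] integral_normal_moment_odd[OF \<sigma>_pos, of 0 0]
    by (simp_all add: moment_eq)
qed

lemma monomial_integral:
  shows integrable_monomial: "integrable (noise n \<sigma>) (\<lambda>u. \<Prod>j<n. u j ^ e j)"
    and integral_monomial: "(\<integral>u. (\<Prod>j<n. u j ^ e j) \<partial>noise n \<sigma>) = (\<Prod>j<n. moment (e j))"
proof -
  interpret product_sigma_finite "\<lambda>_. N"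
    by (simp add: product_sigma_finite_def prob_space_N prob_space_imp_sigma_finite)
  show "integrable (noise n \<sigma>) (\<lambda>u. \<Prod>j<n. u j ^ e j)"
    unfolding noise_def by (rule product_integrable_prod) (simp_all add: integrable_power)
  show "(\<integral>u. (\<Prod>j<n. u j ^ e j) \<partial>noise n \<sigma>) = (\<Prod>j<n. moment (e j))"
    unfolding noise_def moment_def
    by (rule product_integral_prod) (simp_all add: integrable_power)
qed

lemma prod_power_of_bool: "a < n \<Longrightarrow> (\<Prod>j<n. u j ^ of_bool (j = a)) = (u a :: real)"
proof -
  assume "a < n"
  have "(\<Prod>j<n. u j ^ of_bool (j = a)) = (\<Prod>j<n. if j = a then u j else 1)"
    by (intro prod.cong) auto
  then show ?thesis
    using \<open>a < n\<close> by simp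
qed

lemma second_moment:
  assumes "a < n" "b < n"
  shows integrable_second: "integrable (noise n \<sigma>) (\<lambda>u. u a * u b)"
    and integral_second: "(\<integral>u. u a * u b \<partial>noise n \<sigma>) = \<sigma>\<^sup>2 * of_bool (a = b)"
proof -
  \<comment> \<open>\<open>e j\<close> counts how often coordinate \<open>j\<close> occurs. The
    integrand becomes a monomial whose integral factorizes, and coordinates that do not occur
    contribute \<open>moment 0 = 1\<close>.\<close>
  define e :: "nat \<Rightarrow> nat" where "e j = of_bool (j = a) + of_bool (j = b)" for j
  have eq: "(\<lambda>u. u a * u b :: real) = (\<lambda>u. \<Prod>j<n. u j ^ e j)"
    using assms by (simp add: e_def power_add prod.distrib prod_power_of_bool)
  show "integrable (noise n \<sigma>) (\<lambda>u. u a * u b)"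
    unfolding eq by (rule integrable_monomial)
  have "(\<Prod>j<n. moment (e j)) = (\<Prod>j\<in>{a, b}. moment (e j))"
    using assms by (intro prod.mono_neutral_right) (auto simp: e_def moment_simps)
  also have "\<dots> = \<sigma>\<^sup>2 * of_bool (a = b)"
    by (cases "a = b") (auto simp: e_def moment_simps)
  finally show "(\<integral>u. u a * u b \<partial>noise n \<sigma>) = \<sigma>\<^sup>2 * of_bool (a = b)"
    unfolding eq integral_monomial .
qed

text \<open>Isserlis' formula: one term for each pairing of the four indices. An index of odd
  multiplicity makes the integral vanish; if all four agree, the three pairings together give
  \<open>3 * \<sigma> ^ 4\<close>.\<close>

lemma fourth_moment:
  assumes "a < n" "b < n" "c < n" "d < n"
  shows integrable_fourth: "integrable (noise n \<sigma>) (\<lambda>u. u a * u b * (u c * u d))"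
    and integral_fourth: "(\<integral>u. u a * u b * (u c * u d) \<partial>noise n \<sigma>)
      = \<sigma> ^ 4 * (of_bool (a = b \<and> c = d) + of_bool (a = c \<and> b = d) + of_bool (a = d \<and> b = c))"
proof -
  define e :: "nat \<Rightarrow> nat" where
    "e j = of_bool (j = a) + of_bool (j = b) + of_bool (j = c) + of_bool (j = d)" for j
  have eq: "(\<lambda>u. u a * u b * (u c * u d) :: real) = (\<lambda>u. \<Prod>j<n. u j ^ e j)"
    using assms by (simp add: e_def power_add prod.distrib prod_power_of_bool mult.assoc)
  show "integrable (noise n \<sigma>) (\<lambda>u. u a * u b * (u c * u d))"
    unfolding eq by (rule integrable_monomial)
  have "(\<Prod>j<n. moment (e j)) = (\<Prod>j\<in>{a, b, c, d}. moment (e j))"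
    using assms by (intro prod.mono_neutral_right) (auto simp: e_def moment_simps)
  also have "\<dots> = \<sigma> ^ 4 * (of_bool (a = b \<and> c = d) + of_bool (a = c \<and> b = d) + of_bool (a = d \<and> b = c))"
    by (cases "a = b"; cases "a = c"; cases "a = d"; cases "b = c"; cases "b = d"; cases "c = d")
      (simp_all add: e_def moment_simps insert_absorb flip: power_add)
  finally show "(\<integral>u. u a * u b * (u c * u d) \<partial>noise n \<sigma>)
      = \<sigma> ^ 4 * (of_bool (a = b \<and> c = d) + of_bool (a = c \<and> b = d) + of_bool (a = d \<and> b = c))"
    unfolding eq integral_monomial .
qed

definition qform :: "(nat \<Rightarrow> nat \<Rightarrow> real) \<Rightarrow> (nat \<Rightarrow> real) \<Rightarrow> real" where
  "qform R u = (\<Sum>a<n. \<Sum>b<n. R a b * (u a * u b))"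

lemma qform_measurable [measurable]: "qform R \<in> borel_measurable (noise n \<sigma>)"
  unfolding qform_def[abs_def] by measurable

lemma expectation_qform: "expectation (qform R) = \<sigma>\<^sup>2 * (\<Sum>a<n. R a a)"
proof -
  have "expectation (qform R) = (\<Sum>a<n. \<Sum>b<n. R a b * (\<sigma>\<^sup>2 * of_bool (a = b)))"
    unfolding qform_def[abs_def]
    by (intro has_bochner_integral_integral_eq has_bochner_integral_sum has_bochner_integral_mult_right)
      (auto simp: has_bochner_integral_iff integrable_second integral_second)
  also have "\<dots> = (\<Sum>a<n. \<sigma>\<^sup>2 * R a a)"
    by (intro sum.cong refl) (simp add: of_bool_def if_distrib cong: if_cong)
  finally show ?thesis
    by (simp add: sum_distrib_left)
qed

lemma qform_square:
  "(qform R u)\<^sup>2 = (\<Sum>a<n. \<Sum>b<n. \<Sum>c<n. \<Sum>d<n. R a b * R c d * (u a * u b * (u c * u d)))"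
proof -
  have "(qform R u)\<^sup>2 = (\<Sum>a<n. \<Sum>b<n. R a b * (u a * u b) * qform R u)"
    by (simp add: power2_eq_square qform_def sum_distrib_right)
  then show ?thesis
    by (simp add: qform_def sum_distrib_left mult_ac)
qed

lemma integrable_qform_square: "integrable (noise n \<sigma>) (\<lambda>u. (qform R u)\<^sup>2)"
  unfolding qform_square
  by (intro Bochner_Integration.integrable_sum integrable_mult_right) (auto intro: integrable_fourth)

text \<open>The pairing within each factor gives the squared trace. The two pairings across the
  factors give the squared Frobenius norm each, the second of them by symmetry of
  \<open>R\<close>.\<close>

lemma expectation_qform_square:
  assumes sym: "\<And>a b. R a b = R b a"
  shows "expectation (\<lambda>u. (qform R u)\<^sup>2)
    = \<sigma> ^ 4 * ((\<Sum>a<n. R a a)\<^sup>2 + 2 * (\<Sum>a<n. \<Sum>b<n. (R a b)\<^sup>2))"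
proof -
  have "expectation (\<lambda>u. (qform R u)\<^sup>2) = (\<Sum>a<n. \<Sum>b<n. \<Sum>c<n. \<Sum>d<n. R a b * R c d * (\<sigma> ^ 4
      * (of_bool (a = b \<and> c = d) + of_bool (a = c \<and> b = d) + of_bool (a = d \<and> b = c))))"
    unfolding qform_square
    by (intro has_bochner_integral_integral_eq has_bochner_integral_sum has_bochner_integral_mult_right)
      (auto simp: has_bochner_integral_iff integrable_fourth integral_fourth)
  also have "\<dots> = (\<Sum>a<n. \<Sum>b<n. \<sigma> ^ 4 * (of_bool (a = b) * R a b * (\<Sum>c<n. R c c) + 2 * (R a b)\<^sup>2))"
  proof (intro sum.cong refl)
    fix a b assume "a \<in> {..<n}" "b \<in> {..<n}"
    then have ab: "a < n" "b < n"
      by auto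
    have "(\<Sum>c<n. \<Sum>d<n. R a b * R c d * (\<sigma> ^ 4
        * (of_bool (a = b \<and> c = d) + of_bool (a = c \<and> b = d) + of_bool (a = d \<and> b = c))))
      = (\<Sum>c<n. \<Sum>d<n. (if d = c then \<sigma> ^ 4 * of_bool (a = b) * R a b * R c c else 0)
          + (if d = b then (if c = a then \<sigma> ^ 4 * R a b * R a b else 0) else 0)
          + (if d = a then (if c = b then \<sigma> ^ 4 * R a b * R b a else 0) else 0))"
      by (intro sum.cong refl) (auto simp: algebra_simps)
    also have "\<dots> = (\<Sum>c<n. \<sigma> ^ 4 * of_bool (a = b) * R a b * R c c) + \<sigma> ^ 4 * R a b * R a b
        + \<sigma> ^ 4 * R a b * R b a"
      using ab by (simp add: sum.distrib)
    also have "\<dots> = \<sigma> ^ 4 * (of_bool (a = b) * R a b * (\<Sum>c<n. R c c) + 2 * (R a b)\<^sup>2)"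
      using sym[of b a] by (simp add: power2_eq_square distrib_left sum_distrib_left mult_ac)
    finally show "(\<Sum>c<n. \<Sum>d<n. R a b * R c d * (\<sigma> ^ 4
        * (of_bool (a = b \<and> c = d) + of_bool (a = c \<and> b = d) + of_bool (a = d \<and> b = c))))
      = \<sigma> ^ 4 * (of_bool (a = b) * R a b * (\<Sum>c<n. R c c) + 2 * (R a b)\<^sup>2)" .
  qed
  also have "\<dots> = (\<Sum>a<n. \<Sum>b<n. (if b = a then \<sigma> ^ 4 * (R a a * (\<Sum>c<n. R c c)) else 0)
      + \<sigma> ^ 4 * (2 * (R a b)\<^sup>2))"
    by (intro sum.cong refl) (auto simp: algebra_simps)
  also have "\<dots> = (\<Sum>a<n. \<sigma> ^ 4 * (R a a * (\<Sum>c<n. R c c)))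
      + (\<Sum>a<n. \<Sum>b<n. \<sigma> ^ 4 * (2 * (R a b)\<^sup>2))"
    by (simp add: sum.distrib)
  also have "\<dots> = \<sigma> ^ 4 * ((\<Sum>a<n. R a a)\<^sup>2 + 2 * (\<Sum>a<n. \<Sum>b<n. (R a b)\<^sup>2))"
    by (simp add: power2_eq_square distrib_left flip: sum_distrib_left sum_distrib_right)
  finally show ?thesis .
qed

lemma variance_qform:
  assumes "\<And>a b. R a b = R b a"
  shows "variance (qform R) = 2 * \<sigma> ^ 4 * (\<Sum>a<n. \<Sum>b<n. (R a b)\<^sup>2)"
proof -
  have "integrable (noise n \<sigma>) (qform R)"
    by (rule square_integrable_imp_integrable) (auto intro: integrable_qform_square)
  from variance_eq[OF this integrable_qform_square] show ?thesis
    by (simp add: expectation_qform expectation_qform_square[OF assms] power_mult_distrib algebra_simps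
        flip: power_mult)
qed

end

section \<open>Coverage probabilities\<close>

text \<open>One statement for both scales: \<open>S\<close> is either the estimate or the constant
  \<sigma>, and in the latter case \<open>\<delta>\<close> and \<open>p\<close> may be 0. The lower
  bound holds for every \<theta>; the upper bound needs \<theta> far enough out.\<close>

lemma (in prob_space) soft_interval_coverage:
  fixes S e :: "'a \<Rightarrow> real"
  assumes e: "distributed M lborel e (normal_density 0 (\<sigma> * \<tau>))" and pos: "0 < \<sigma>" "0 < \<tau>"
    and S [measurable]: "random_variable borel S" and S_nonneg: "\<And>\<omega>. \<omega> \<in> space M \<Longrightarrow> 0 \<le> S \<omega>"
    and \<delta>: "0 \<le> \<delta>" "\<delta> \<le> 1/2"
    and S_near: "prob {\<omega> \<in> space M. \<not> \<bar>S \<omega> / \<sigma> - 1\<bar> \<le> \<delta>} \<le> p"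
    and b: "0 \<le> b"
  shows soft_interval_coverage_ge:
    "measure std_normal {(b - a) / \<tau> .. (b + a) / \<tau>} - 4 * \<delta> - p
      \<le> prob {\<omega> \<in> space M. \<bar>soft (S \<omega> * b) (\<theta> + e \<omega>) - \<theta>\<bar> \<le> S \<omega> * a}" (is "?m - _ - _ \<le> prob ?C")
    and soft_interval_coverage_le:
    "0 \<le> a \<Longrightarrow> (1 + \<delta>) * \<sigma> * a < \<theta> \<Longrightarrow>
      prob {\<omega> \<in> space M. \<bar>soft (S \<omega> * b) (\<theta> + e \<omega>) - \<theta>\<bar> \<le> S \<omega> * a}
        \<le> measure std_normal {(b - a) / \<tau> .. (b + a) / \<tau>} + 4 * \<delta> + p"
proof -
  have [measurable]: "e \<in> borel_measurable M"
    using distributed_measurable[OF e] by simp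
  define Z where "Z \<omega> = e \<omega> / (\<sigma> * \<tau>)" for \<omega>
  have Z: "distributed M lborel Z (normal_density 0 1)"
    using normal_standard_normal_convert[of "\<sigma> * \<tau>" e 0] e pos by (simp add: Z_def[abs_def])
  \<comment> \<open>The reflected variable serves negative \<theta>, where the sufficient event is
    the mirror image.\<close>
  have Z': "distributed M lborel (\<lambda>\<omega>. - Z \<omega>) (normal_density 0 1)"
    using normal_density_affine[OF Z, of "-1" 0] by simp
  have W: "random_variable borel (\<lambda>\<omega>. S \<omega> / \<sigma>)"
    by measurable
  have C: "?C \<in> events"
    by measurable
  have scale: "S \<omega> / \<sigma> * ((b - a) / \<tau>) \<le> z / (\<sigma> * \<tau>) \<and> z / (\<sigma> * \<tau>) \<le> S \<omega> / \<sigma> * ((b + a) / \<tau>)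
      \<longleftrightarrow> \<bar>z - S \<omega> * b\<bar> \<le> S \<omega> * a" for z \<omega>
  proof -
    have cancel: "x / c \<le> y / c \<longleftrightarrow> x \<le> y" if "0 < c" for x y c :: real
      using that by (simp add: divide_le_cancel)
    have "S \<omega> / \<sigma> * ((b - a) / \<tau>) = (S \<omega> * b - S \<omega> * a) / (\<sigma> * \<tau>)"
      "S \<omega> / \<sigma> * ((b + a) / \<tau>) = (S \<omega> * b + S \<omega> * a) / (\<sigma> * \<tau>)"
      by (simp_all add: algebra_simps)
    then show ?thesis
      by (simp only: cancel[OF mult_pos_pos[OF pos]]) linarith
  qed
  note ge = rescaled_interval_prob_ge[OF _ W \<delta> S_near C]
  note le = rescaled_interval_prob_le[OF _ W \<delta> S_near C]
  show "?m - 4 * \<delta> - p \<le> prob ?C"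
  proof (cases "0 \<le> \<theta>")
    case True
    show ?thesis
    proof (rule ge[OF Z])
      fix \<omega> assume \<omega>: "\<omega> \<in> space M" "S \<omega> / \<sigma> * ((b - a) / \<tau>) \<le> Z \<omega>" "Z \<omega> \<le> S \<omega> / \<sigma> * ((b + a) / \<tau>)"
      then have "\<bar>e \<omega> - S \<omega> * b\<bar> \<le> S \<omega> * a"
        using scale[of \<omega> "e \<omega>"] by (simp add: Z_def)
      then show "\<bar>soft (S \<omega> * b) (\<theta> + e \<omega>) - \<theta>\<bar> \<le> S \<omega> * a"
        using True b S_nonneg[OF \<omega>(1)] by (intro soft_covers) auto
    qed
  next
    case False
    show ?thesis
    proof (rule ge[OF Z'])
      fix \<omega> assume \<omega>: "\<omega> \<in> space M" "S \<omega> / \<sigma> * ((b - a) / \<tau>) \<le> - Z \<omega>" "- Z \<omega> \<le> S \<omega> / \<sigma> * ((b + a) / \<tau>)"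
      then have "\<bar>- e \<omega> - S \<omega> * b\<bar> \<le> S \<omega> * a"
        using scale[of \<omega> "- e \<omega>"] by (simp add: Z_def)
      then have "\<bar>e \<omega> + S \<omega> * b\<bar> \<le> S \<omega> * a"
        by linarith
      then show "\<bar>soft (S \<omega> * b) (\<theta> + e \<omega>) - \<theta>\<bar> \<le> S \<omega> * a"
        using False b S_nonneg[OF \<omega>(1)] by (intro soft_covers_neg) auto
    qed
  qed
  show "prob ?C \<le> ?m + 4 * \<delta> + p" if a: "0 \<le> a" and far: "(1 + \<delta>) * \<sigma> * a < \<theta>"
  proof (rule le[OF Z])
    fix \<omega> assume \<omega>: "\<omega> \<in> space M" "\<bar>S \<omega> / \<sigma> - 1\<bar> \<le> \<delta>" "\<bar>soft (S \<omega> * b) (\<theta> + e \<omega>) - \<theta>\<bar> \<le> S \<omega> * a"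
    \<comment> \<open>On the event that the scale is near \<sigma>, the random half-length
      \<open>S \<omega> * a\<close> stays below the fixed threshold assumed for \<theta>.\<close>
    have "S \<omega> / \<sigma> \<le> 1 + \<delta>"
      using \<omega>(2) by linarith
    then have "S \<omega> \<le> (1 + \<delta>) * \<sigma>"
      using pos by (simp add: divide_le_eq)
    then have "S \<omega> * a < \<theta>"
      using far a by (smt (verit) mult_right_mono)
    then have "\<bar>e \<omega> - S \<omega> * b\<bar> \<le> S \<omega> * a"
      by (rule soft_covers_far[OF mult_nonneg_nonneg[OF S_nonneg[OF \<omega>(1)] b] _ \<omega>(3)])
    then show "S \<omega> / \<sigma> * ((b - a) / \<tau>) \<le> Z \<omega> \<and> Z \<omega> \<le> S \<omega> / \<sigma> * ((b + a) / \<tau>)"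
      using scale[of \<omega> "e \<omega>"] by (simp add: Z_def)
  qed
qed

section \<open>Concentration of the variance estimate and comparison of the two infima\<close>

context full_rank_design
begin

lemma sigma_hat_nonneg: "k < n \<Longrightarrow> 0 \<le> sigma_hat n k X y"
  by (simp add: sigma_hat_def sum_nonneg)

text \<open>Chebyshev's inequality for u'Ru, with mean \<open>\<sigma>\<^sup>2 * (n - k)\<close> and
  variance \<open>2 * \<sigma> ^ 4 * (n - k)\<close>. The bound is the same for all \<theta> and
  \<sigma>.\<close>

lemma sigma_hat_concentration:
  assumes "k < n" "0 < \<sigma>" "0 < \<delta>"
  shows "measure (noise n \<sigma>) {u \<in> space (noise n \<sigma>).
      \<not> \<bar>sigma_hat n k X (\<lambda>j. (\<Sum>c<k. X j c * \<theta> c) + u j) / \<sigma> - 1\<bar> \<le> \<delta>}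
    \<le> 2 / (\<delta>\<^sup>2 * (real n - real k))"
proof -
  interpret gaussian_noise n \<sigma>
    by standard fact
  define s where "s u = sigma_hat n k X (\<lambda>j. (\<Sum>c<k. X j c * \<theta> c) + u j)" for u
  define D where "D = \<sigma>\<^sup>2 * (real n - real k)"
  have D: "0 < D"
    using assms by (simp add: D_def)
  have s_eq: "s u = sqrt (qform resid u / (real n - real k))" for u
    by (simp add: s_def sigma_hat_model qform_def)
  \<comment> \<open>For a symmetric idempotent matrix the squared Frobenius norm equals the
    trace.\<close>
  have "(\<Sum>a<n. \<Sum>b<n. (resid a b)\<^sup>2) = (\<Sum>a<n. \<Sum>b<n. resid a b * resid b a)"
    by (simp add: power2_eq_square resid_sym[of _ "_ :: nat"])
  also have "\<dots> = real n - real k"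
    by (simp add: resid_idem resid_trace)
  finally have frob: "(\<Sum>a<n. \<Sum>b<n. (resid a b)\<^sup>2) = real n - real k" .
  have "prob {u \<in> space (noise n \<sigma>). \<not> \<bar>s u / \<sigma> - 1\<bar> \<le> \<delta>}
      \<le> prob {u \<in> space (noise n \<sigma>). D * \<delta> \<le> \<bar>qform resid u - expectation (qform resid)\<bar>}"
  proof (rule finite_measure_mono)
    show "{u \<in> space (noise n \<sigma>). \<not> \<bar>s u / \<sigma> - 1\<bar> \<le> \<delta>}
        \<subseteq> {u \<in> space (noise n \<sigma>). D * \<delta> \<le> \<bar>qform resid u - expectation (qform resid)\<bar>}"
    proof safe
      fix u assume "\<not> \<bar>s u / \<sigma> - 1\<bar> \<le> \<delta>"
      then have W: "\<delta> < \<bar>s u / \<sigma> - 1\<bar>"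
        by simp
      have s: "0 \<le> s u"
        unfolding s_def using assms by (intro sigma_hat_nonneg)
      then have "0 \<le> qform resid u / (real n - real k)"
        by (simp add: s_eq)
      then have "qform resid u = (real n - real k) * (s u)\<^sup>2"
        using assms by (simp add: s_eq)
      moreover have "D * (s u / \<sigma>)\<^sup>2 = (real n - real k) * (s u)\<^sup>2"
        using assms by (simp add: D_def power_divide)
      ultimately have "qform resid u - D = D * ((s u / \<sigma>)\<^sup>2 - 1)"
        by (simp add: right_diff_distrib)
      also have "\<dots> = D * ((s u / \<sigma> - 1) * (s u / \<sigma> + 1))"
        by (simp add: power2_eq_square algebra_simps)
      finally have "\<bar>qform resid u - D\<bar> = D * (\<bar>s u / \<sigma> - 1\<bar> * \<bar>s u / \<sigma> + 1\<bar>)"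
        using D by (simp add: abs_mult)
      \<comment> \<open>The second factor is at least 1, so a deviation of the ratio is at most that
        of its square, and no square root has to be estimated.\<close>
      moreover have "\<delta> * 1 \<le> \<bar>s u / \<sigma> - 1\<bar> * \<bar>s u / \<sigma> + 1\<bar>"
        using W s assms by (intro mult_mono) auto
      ultimately have "D * \<delta> \<le> \<bar>qform resid u - D\<bar>"
        using D by simp
      then show "D * \<delta> \<le> \<bar>qform resid u - expectation (qform resid)\<bar>"
        by (simp add: expectation_qform resid_trace D_def)
    qed
  qed measurable
  also have "\<dots> \<le> variance (qform resid) / (D * \<delta>)\<^sup>2"
    using D assms by (intro Chebyshev_inequality integrable_qform_square) auto
  also have "variance (qform resid) = 2 * \<sigma> ^ 4 * (real n - real k)"
    using variance_qform[OF resid_sym] frob by simp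
  also have "2 * \<sigma> ^ 4 * (real n - real k) / (D * \<delta>)\<^sup>2 = 2 / (\<delta>\<^sup>2 * (real n - real k))"
  proof -
    have "2 * \<sigma> ^ 4 * r / (\<sigma>\<^sup>2 * r * \<delta>)\<^sup>2 = 2 / (\<delta>\<^sup>2 * r)" if "0 < r" for r :: real
      using that assms by (simp add: power_mult_distrib power2_eq_square power4_eq_xxxx)
    then show ?thesis
      using assms by (simp add: D_def)
  qed
  finally show ?thesis
    by (simp add: s_def)
qed

text \<open>Both infima are compared with the number \<open>m\<close> below. Lower bounds hold at
  every parameter, and a single far-out \<theta> supplies both upper bounds. The resulting error
  depends only on \<open>\<delta>\<close> and \<open>n - k\<close>.\<close>

lemma coverage_infima_close:
  assumes kn: "k < n" and i: "i < k" and \<sigma>: "0 < \<sigma>" and a: "0 \<le> a" and \<eta>: "0 < \<eta>"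
    and \<delta>: "0 < \<delta>" "\<delta> \<le> 1/2"
  shows "\<bar>(INF p \<in> {(\<theta>, s). \<theta> \<in> Rk k \<and> s > 0}.
         Pmodel n k X (fst p) (snd p)
           (\<lambda>y. fst p i \<in> {thetaS_feas n k X \<eta> i y - sigma_hat n k X y * a ..
                             thetaS_feas n k X \<eta> i y + sigma_hat n k X y * a}))
    - (INF \<theta> \<in> Rk k.
         Pmodel n k X \<theta> \<sigma>
           (\<lambda>y. \<theta> i \<in> {thetaS n k X \<sigma> \<eta> i y - \<sigma> * a ..
                         thetaS n k X \<sigma> \<eta> i y + \<sigma> * a}))\<bar>
    \<le> 4 * \<delta> + 2 / (\<delta>\<^sup>2 * (real n - real k))"
    (is "\<bar>(INF p \<in> ?PS. ?F p) - (INF \<theta> \<in> Rk k. ?G \<theta>)\<bar> \<le> 4 * \<delta> + ?p")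
proof -
  \<comment> \<open>\<open>\<tau>\<close> is the standard deviation of the least squares error in
    units of the noise level, so \<open>m\<close> involves neither \<theta> nor \<sigma>.\<close>
  define \<tau> where "\<tau> = sqrt (Ginv i i)"
  define b where "b = xi n k X i * \<eta>"
  define m where "m = measure std_normal {(b - a) / \<tau> .. (b + a) / \<tau>}"
  define e where "e u = (\<Sum>j<n. lsw i j * u j)" for u :: "nat \<Rightarrow> real"
  define y where "y \<theta> u = (\<lambda>j. (\<Sum>c<k. X j c * \<theta> c) + u j)" for \<theta> u :: "nat \<Rightarrow> real"
  have \<tau>: "0 < \<tau>"
    using Ginv_diag_pos[OF i] by (simp add: \<tau>_def)
  have "0 \<le> Ginv i i"
    using Ginv_diag_pos[OF i] by simp
  then have b: "0 \<le> b"
    using kn \<eta> by (simp add: b_def xi_eq)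
  have e: "distributed (noise n s) lborel e (normal_density 0 (s * \<tau>))" if "0 < s" for s
  proof -
    interpret gaussian_noise n s
      by standard fact
    show ?thesis
      using distributed_linear[of "lsw i"] lsw_norm[OF i] Ginv_diag_pos[OF i] by (simp add: e_def[abs_def] \<tau>_def)
  qed
  have LS: "thetaLS n k X (y \<theta> u) i = \<theta> i + e u" for \<theta> u
    using thetaLS_model[OF i] by (simp add: y_def e_def)
  have F: "?F (\<theta>, s) = measure (noise n s) {u \<in> space (noise n s).
      \<bar>soft (sigma_hat n k X (y \<theta> u) * b) (\<theta> i + e u) - \<theta> i\<bar> \<le> sigma_hat n k X (y \<theta> u) * a}" for \<theta> s
    unfolding Pmodel_def fst_conv snd_conv y_def[symmetric] thetaS_feas_def LS b_def
    by (rule arg_cong[where f = "measure _"]) (auto simp: abs_le_iff mult.assoc)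
  have G: "?G \<theta> = measure (noise n \<sigma>) {u \<in> space (noise n \<sigma>).
      \<bar>soft (\<sigma> * b) (\<theta> i + e u) - \<theta> i\<bar> \<le> \<sigma> * a}" for \<theta>
    unfolding Pmodel_def y_def[symmetric] thetaS_def LS b_def
    by (rule arg_cong[where f = "measure _"]) (auto simp: abs_le_iff mult.assoc)
  \<comment> \<open>The summand 1 makes the threshold inequality strict; the factor
    \<open>1 + \<delta>\<close> covers the estimated scale, and hence the known one too.\<close>
  define \<theta>far where "\<theta>far = (\<lambda>j. if j = i then (1 + \<delta>) * \<sigma> * a + 1 else 0)"
  have far: "\<theta>far \<in> Rk k" "(1 + \<delta>) * \<sigma> * a < \<theta>far i" "(1 + 0) * \<sigma> * a < \<theta>far i"
    using i \<delta> \<sigma> a by (auto simp: \<theta>far_def Rk_def distrib_right add_nonneg_pos)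
  have sh_meas: "(\<lambda>u. sigma_hat n k X (y \<theta> u)) \<in> borel_measurable (noise n s)" if "0 < s" for \<theta> s
  proof -
    interpret gaussian_noise n s
      by standard fact
    show ?thesis
      unfolding y_def sigma_hat_model by measurable
  qed
  have F_ge: "m - 4 * \<delta> - ?p \<le> ?F (\<theta>, s)" if s: "0 < s" for \<theta> s
  proof -
    interpret gaussian_noise n s
      by standard fact
    show ?thesis
      unfolding F m_def
      by (rule soft_interval_coverage_ge[OF e[OF s] s \<tau> sh_meas[OF s]])
        (use \<delta> b kn s sigma_hat_nonneg sigma_hat_concentration in \<open>auto simp: y_def\<close>)
  qed
  have F_le: "?F (\<theta>far, \<sigma>) \<le> m + 4 * \<delta> + ?p"
  proof -
    interpret gaussian_noise n \<sigma>
      by standard fact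
    show ?thesis
      unfolding F m_def
      by (rule soft_interval_coverage_le[OF e[OF \<sigma>] \<sigma> \<tau> sh_meas[OF \<sigma>]])
        (use far \<delta> a b kn \<sigma> sigma_hat_nonneg sigma_hat_concentration in \<open>auto simp: y_def\<close>)
  qed
  interpret gaussian_noise n \<sigma>
    by standard fact
  \<comment> \<open>With the constant scale \<sigma> both error terms are 0, so the known-variance
    infimum is exactly \<open>m\<close>.\<close>
  have G_ge: "m \<le> ?G \<theta>" for \<theta>
    unfolding G m_def
    using soft_interval_coverage_ge[OF e[OF \<sigma>] \<sigma> \<tau>, of "\<lambda>_. \<sigma>" 0 0 b a "\<theta> i"] \<sigma> b by simp
  have G_le: "?G \<theta>far \<le> m"
    unfolding G m_def
    using soft_interval_coverage_le[OF e[OF \<sigma>] \<sigma> \<tau>, of "\<lambda>_. \<sigma>" 0 0 b a "\<theta>far i"] \<sigma> a b far(3) by simp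
  have "m - 4 * \<delta> - ?p \<le> (INF p \<in> ?PS. ?F p)"
  proof (rule cINF_greatest)
    show "?PS \<noteq> {}"
      using far(1) \<sigma> by auto
    show "m - 4 * \<delta> - ?p \<le> ?F p" if "p \<in> ?PS" for p
      using F_ge[of "snd p" "fst p"] that by auto
  qed
  \<comment> \<open>The variance is free in this infimum, so the fixed \<sigma> is an admissible
    choice. Probabilities are bounded below by 0, as the conditionally complete infimum
    requires.\<close>
  moreover have "(INF p \<in> ?PS. ?F p) \<le> ?F (\<theta>far, \<sigma>)"
    by (rule cINF_lower) (use far(1) \<sigma> in \<open>auto simp: Pmodel_def intro!: bdd_belowI2[where m = 0]\<close>)
  moreover have "m \<le> (INF \<theta> \<in> Rk k. ?G \<theta>)"
    by (rule cINF_greatest) (use far(1) G_ge in auto)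
  moreover have "(INF \<theta> \<in> Rk k. ?G \<theta>) \<le> ?G \<theta>far"
    by (rule cINF_lower) (use far(1) in \<open>auto simp: Pmodel_def intro!: bdd_belowI2[where m = 0]\<close>)
  ultimately show ?thesis
    using F_le G_le by (simp only: abs_le_iff) linarith
qed

end

section \<open>Passage to the limit\<close>

theorem theorem17:
  fixes k :: "nat \<Rightarrow> nat" and X :: "nat \<Rightarrow> nat \<Rightarrow> nat \<Rightarrow> real"
    and \<eta> :: "nat \<Rightarrow> real" and a :: "nat \<Rightarrow> real" and i :: nat and \<sigma> :: real
  assumes "\<forall>n. 1 \<le> k n"
    and "\<forall>n\<ge>1. full_col_rank n (k n) (X n)"
    and "\<forall>n. \<eta> n > 0"
    and "bdd_above ((\<lambda>n. (xi n (k n) (X n) i)\<^sup>2 / real n) ` {1..})"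
    and "eventually (\<lambda>n. i < k n) sequentially"
    and "(\<lambda>n. xi n (k n) (X n) i * \<eta> n) \<longlonglongrightarrow> 0"
    and "\<forall>n. a n \<ge> 0"
    and "\<sigma> > 0"
  shows "((\<lambda>n.
      (INF p \<in> {(\<theta>, s). \<theta> \<in> Rk (k n) \<and> s > 0}.
         Pmodel n (k n) (X n) (fst p) (snd p)
           (\<lambda>y. fst p i \<in> {thetaS_feas n (k n) (X n) (\<eta> n) i y - sigma_hat n (k n) (X n) y * a n ..
                             thetaS_feas n (k n) (X n) (\<eta> n) i y + sigma_hat n (k n) (X n) y * a n}))
    - (INF \<theta> \<in> Rk (k n).
         Pmodel n (k n) (X n) \<theta> \<sigma>
           (\<lambda>y. \<theta> i \<in> {thetaS n (k n) (X n) \<sigma> (\<eta> n) i y - \<sigma> * a n ..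
                         thetaS n (k n) (X n) \<sigma> (\<eta> n) i y + \<sigma> * a n})))
    \<longlongrightarrow> 0) (filtercomap (\<lambda>n. n - k n) at_top)"
  (is "(?d \<longlongrightarrow> 0) ?F")
proof -
  \<comment> \<open>Since \<open>n - k n \<le> n\<close>, the filter of growing
    \<open>n - k n\<close> is finer than \<open>sequentially\<close>.\<close>
  have n_top: "eventually P ?F" if P: "eventually P sequentially" for P
  proof -
    obtain N where N: "\<And>n. N \<le> n \<Longrightarrow> P n"
      using P by (auto simp: eventually_sequentially)
    show ?thesis
      unfolding eventually_filtercomap
    proof (intro exI conjI allI impI)
      show "eventually (\<lambda>m. N \<le> m) at_top"
        by (rule eventually_ge_at_top)
      show "P n" if "N \<le> n - k n" for n
        using that by (intro N) linarith
    qed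
  qed
  have large: "eventually (\<lambda>n. N \<le> n - k n) ?F" for N
    by (rule eventually_filtercomapI) (rule eventually_ge_at_top)
  show ?thesis
  proof (rule tendstoI)
    fix \<epsilon> :: real
    assume \<epsilon>: "0 < \<epsilon>"
    \<comment> \<open>The cap 1/2 is what the normal estimates need; the other term keeps
      \<open>4 * \<delta>\<close> within a quarter of \<open>\<epsilon>\<close>. The choice of
      \<open>N\<close> then brings the Chebyshev term below \<open>\<epsilon> / 2\<close>.\<close>
    define \<delta> where "\<delta> = min (1/2) (\<epsilon> / 16)"
    have \<delta>: "0 < \<delta>" "\<delta> \<le> 1/2" "4 * \<delta> \<le> \<epsilon> / 4"
      using \<epsilon> by (auto simp: \<delta>_def)
    obtain N :: nat where N: "4 / (\<delta>\<^sup>2 * \<epsilon>) < real N"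
      using reals_Archimedean2 by blast
    show "eventually (\<lambda>n. dist (?d n) 0 < \<epsilon>) ?F"
      \<comment> \<open>\<open>Suc N\<close> keeps the truncated difference positive, which yields
        \<open>k n < n\<close> and \<open>n \<ge> 1\<close>, as the rank hypothesis demands.\<close>
      using n_top[OF assms(5)] large[of "Suc N"]
    proof eventually_elim
      fix n
      assume i: "i < k n" and n: "Suc N \<le> n - k n"
      interpret full_rank_design n "k n" "X n"
        by standard (use assms(2) n in auto)
      have kn: "k n < n"
        using n by linarith
      have "4 / (\<delta>\<^sup>2 * \<epsilon>) < real n - real (k n)"
        using N n kn by linarith
      then have "2 / (\<delta>\<^sup>2 * (real n - real (k n))) < \<epsilon> / 2"
        using \<delta> \<epsilon> kn by (simp add: field_simps)
      then have "4 * \<delta> + 2 / (\<delta>\<^sup>2 * (real n - real (k n))) < \<epsilon>"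
        using \<delta> \<epsilon> by linarith
      moreover have "\<bar>?d n\<bar> \<le> 4 * \<delta> + 2 / (\<delta>\<^sup>2 * (real n - real (k n)))"
        using assms(3,7,8) by (intro coverage_infima_close kn i \<delta>) auto
      ultimately show "dist (?d n) 0 < \<epsilon>"
        by (simp add: dist_real_def)
    qed
  qed
qed

end
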